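(* Let $b\ge1$ and let $(t_1,\dots,t_b)$ be an admissible sequence with dual sequence $(T_1,\dots,T_b)$, $T_j=h(t_1,\dots,t_j)$. Then: (i) for each $1\le j\le b$, the product $\prod_{k=1}^jT_k$ is an integer; (ii) if $|\prod_{k=1}^bT_k|=1$ and either $T_b=1$ or $T_b<0$, then there exists a positive integer $t_{b+1}$ such that $(t_1,\dots,t_{b+1})$ is primitive; (iii) if $|\prod_{k=1}^bT_k|=1$ and either $T_b=\frac12$ or $T_b<0$, then there exists a positive integer $t_{b+1}$ such that $T_{b+1}:=2-t_{b+1}-1/T_b=-1$; (iv) if $|\prod_{k=1}^bT_k|=1$ and $T_b<0$, then there exists a positive integer $t_{b+1}$ such that $T_{b+1}:=2-t_{b+1}-1/T_b=1$.
   Context: For positive integers $t_1,t_2,\dots$ define rationals $h(t_1)=2-t_1$ and $h(t_1,\dots,t_j)=2-t_j-1/h(t_1,\dots,t_{j-1})$ for $j\ge2$. A sequence $(t_1,\dots,t_b)$ ($b\ge0$) of positive integers is admissible if $h(t_1),h(t_1,t_2),\dots,h(t_1,\dots,t_b)$ are all nonzero. A sequence $(t_1,\dots,t_{b+1})$ of positive integers is primitive if $(t_1,\dots,t_b)$ is admissible and $h(t_1,\dots,t_{b+1})=2-t_{b+1}-1/h(t_1,\dots,t_b)=0$. The dual sequence of $(t_1,\dots,t_b)$ is $(h(t_1),h(t_1,t_2),\dots,h(t_1,\dots,t_b))$. *)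

theory Defs
  imports Complex_Main
begin

text \<open>
  Finite sequences \<open>(t\<^sub>1, \<dots>, t\<^sub>b)\<close> are lists, so \<open>t\<^sub>j\<close> is \<open>ts ! (j - 1)\<close> and
  \<open>(t\<^sub>1, \<dots>, t\<^sub>j)\<close> is \<open>take j ts\<close>. The recursion for \<open>h\<close> peels off the last entry; its value
  on the empty list is irrelevant. The facts \<open>h_singleton\<close> and \<open>h_snoc\<close> are the two
  defining equations in their usual form.
\<close>

fun h :: "nat list \<Rightarrow> rat" where
  "h ts = (if length ts \<le> 1 then 2 - of_nat (last ts)
           else 2 - of_nat (last ts) - 1 / h (butlast ts))"

declare h.simps [simp del]

lemma h_singleton: "h [t] = 2 - of_nat t"
  by (simp add: h.simps)

lemma h_snoc: "ts \<noteq> [] \<Longrightarrow> h (ts @ [t]) = 2 - of_nat t - 1 / h ts"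
  by (subst h.simps) (cases ts; simp)

definition admissible :: "nat list \<Rightarrow> bool" where
  "admissible ts \<longleftrightarrow>
     (\<forall>t\<in>set ts. t > 0) \<and> (\<forall>j\<in>{1..length ts}. h (take j ts) \<noteq> 0)"

definition primitive :: "nat list \<Rightarrow> bool" where
  "primitive ts \<longleftrightarrow>
     ts \<noteq> [] \<and> (\<forall>t\<in>set ts. t > 0) \<and> admissible (butlast ts) \<and> h ts = 0"

definition dual_seq :: "nat list \<Rightarrow> rat list" where
  "dual_seq ts = map (\<lambda>j. h (take j ts)) [1..<length ts + 1]"

end

theory Submission
  imports Defs
begin

text \<open>
  The partial products \<open>P j = T 1 \<cdots> T j\<close> satisfy the linear recurrence
  \<open>P (j + 2) = (2 - t (j + 2)) P (j + 1) - P j\<close> and are therefore integers. If \<open>\<bar>P b\<bar> = 1\<close>,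
  then \<open>1 / T b = P (b - 1) / P b\<close> is an integer too, so that \<open>2 - t - 1 / T b\<close> attains every
  integer \<open>c\<close> with \<open>2 - c - 1 / T b > 0\<close> at a positive integer \<open>t\<close>.
\<close>

lemma h_take_Suc:
  assumes "0 < j" "j < length ts"
  shows "h (take (Suc j) ts) = 2 - of_nat (ts ! j) - 1 / h (take j ts)"
  using assms by (auto simp: take_Suc_conv_app_nth intro!: h_snoc)

lemma prod_h_take_Ints:
  assumes "admissible ts" "j \<le> length ts"
  shows "(\<Prod>k=1..j. h (take k ts)) \<in> \<int>"
  using assms(2)
\<comment> \<open>The recurrence for the partial products has order two, hence two base
  cases.\<close>
proof (induction j rule: induct_nat_012)
  case 0
  then show ?case by simp
next
  case 1
  then show ?case by (cases ts) (auto simp: h_singleton)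
next
  case (ge2 j)
  let ?P = "\<lambda>j. \<Prod>k=1..j. h (take k ts)"
  have nz: "h (take (Suc j) ts) \<noteq> 0"
    using assms(1) ge2.prems by (auto simp: admissible_def)
  have "?P (Suc (Suc j)) = ?P j * (h (take (Suc j) ts) * h (take (Suc (Suc j)) ts))"
    by simp
  \<comment> \<open>Multiplying the recursion for \<open>h\<close> by
    \<open>h (take (Suc j) ts)\<close>, nonzero by admissibility, clears the fraction and leaves the
    \<open>- 1\<close>.\<close>
  also have "\<dots> = ?P j * ((2 - of_nat (ts ! Suc j)) * h (take (Suc j) ts) - 1)"
    using ge2.prems nz by (simp add: h_take_Suc field_simps)
  also have "\<dots> = (2 - of_nat (ts ! Suc j)) * ?P (Suc j) - ?P j"
    by (simp add: algebra_simps)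
  finally show ?case
    using ge2 by (simp only:) (intro Ints_diff Ints_mult Ints_of_nat Ints_numeral; simp)
qed

text \<open>Since \<open>x * y\<close> is 1 or -1, the inverse of \<open>y\<close> is
  \<open>x\<close> up to sign. Here \<open>y\<close> will be the last dual entry and
  \<open>x\<close> the product of the earlier ones.\<close>

lemma inverse_Ints_if_abs_mult_eq_1:
  fixes x y :: "'a :: linordered_field"
  assumes "x \<in> \<int>" "\<bar>x * y\<bar> = 1"
  shows "1 / y \<in> \<int>"
proof -
  have "y \<noteq> 0" using assms(2) by auto
  moreover have "x * y = 1 \<or> x * y = -1" using assms(2) by linarith
  ultimately have "1 / y = x \<or> 1 / y = - x" by (auto simp: field_simps)
  then show ?thesis using assms(1) by auto
qed

text \<open>The witness is the integer \<open>2 - c - x\<close>. With \<open>x = 1 / T b\<close>,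
  \<open>c\<close> is the prescribed next dual entry: 0, -1 and 1 in the three existence
  claims.\<close>

lemma obtain_next_entry:
  fixes x c :: "'a :: linordered_idom"
  assumes "x \<in> \<int>" "c \<in> \<int>" "2 - c - x > 0"
  obtains t :: nat where "t > 0" "2 - of_nat t - x = c"
proof -
  have "2 - c - x \<in> \<int>" using assms by simp
  then obtain n where n: "2 - c - x = of_int n" by (auto elim: Ints_cases)
  then have "n > 0" using assms(3) by simp
  moreover from this have "2 - of_nat (nat n) - x = c" using n by (simp add: algebra_simps)
  ultimately show thesis using that[of "nat n"] by simp
qed

lemma primitive_snoc:
  assumes "admissible ts" "ts \<noteq> []" "t > 0" "2 - of_nat t - 1 / h ts = 0"
  shows "primitive (ts @ [t])"
  using assms by (auto simp: primitive_def admissible_def h_snoc)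

theorem theorem5p5:
  fixes ts :: "nat list" and b :: nat and T :: "nat \<Rightarrow> rat"
  assumes "b \<ge> 1"
    and "length ts = b"
    and "admissible ts"
    and "\<And>j. 1 \<le> j \<Longrightarrow> j \<le> b \<Longrightarrow> T j = dual_seq ts ! (j - 1)"
  shows "(\<forall>j. 1 \<le> j \<and> j \<le> b \<longrightarrow> (\<Prod>k=1..j. T k) \<in> \<int>)
    \<and> (\<bar>\<Prod>k=1..b. T k\<bar> = 1 \<and> (T b = 1 \<or> T b < 0) \<longrightarrow>
           (\<exists>t::nat. t > 0 \<and> primitive (ts @ [t])))
    \<and> (\<bar>\<Prod>k=1..b. T k\<bar> = 1 \<and> (T b = 1 / 2 \<or> T b < 0) \<longrightarrow>
           (\<exists>t::nat. t > 0 \<and> 2 - of_nat t - 1 / T b = -1))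
    \<and> (\<bar>\<Prod>k=1..b. T k\<bar> = 1 \<and> T b < 0 \<longrightarrow>
           (\<exists>t::nat. t > 0 \<and> 2 - of_nat t - 1 / T b = 1))"
proof -
  \<comment> \<open>List positions start at 0, so position \<open>j - 1\<close> holds the value for
    the prefix of length \<open>j\<close>. Keeping \<open>upt\<close> folded lets the simplifier
    index into it.\<close>
  have T: "T j = h (take j ts)" if "1 \<le> j" "j \<le> b" for j
    using assms(2,4) that by (simp add: dual_seq_def del: upt_Suc)
  have P: "(\<Prod>k=1..j. T k) \<in> \<int>" if "j \<le> b" for j
  proof -
    have "(\<Prod>k=1..j. T k) = (\<Prod>k=1..j. h (take k ts))"
      using that by (intro prod.cong) (auto simp: T)
    then show ?thesis using prod_h_take_Ints assms(2,3) that by simp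
  qed
  have Tb: "T b = h ts" using T assms(1,2) by simp
  have inv: "1 / T b \<in> \<int>" if "\<bar>\<Prod>k=1..b. T k\<bar> = 1"
  proof (rule inverse_Ints_if_abs_mult_eq_1)
    \<comment> \<open>For \<open>b = 1\<close> this is the empty product 1.\<close>
    show "(\<Prod>k=1..b-1. T k) \<in> \<int>" by (rule P) simp
    show "\<bar>(\<Prod>k=1..b-1. T k) * T b\<bar> = 1"
      using that assms(1) by (cases b) simp_all
  qed
  have neg: "1 / T b < 0" if "T b < 0"
    using that by simp
  have "\<exists>t::nat. t > 0 \<and> primitive (ts @ [t])"
    if P1: "\<bar>\<Prod>k=1..b. T k\<bar> = 1" and sgn: "T b = 1 \<or> T b < 0"
  proof -
    \<comment> \<open>The target is \<open>c = 0\<close>; the left side is 1 if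
      \<open>T b = 1\<close> and exceeds 2 if \<open>T b < 0\<close>.\<close>
    have "2 - 0 - 1 / T b > 0" using sgn
    proof
      assume "T b < 0" then show ?thesis using neg by linarith
    qed simp
    then obtain t :: nat where "t > 0" "2 - of_nat t - 1 / T b = 0"
      using obtain_next_entry[of "1 / T b" 0] inv[OF P1] by (metis Ints_0)
    moreover have "ts \<noteq> []" using assms(1,2) by auto
    ultimately show ?thesis using primitive_snoc assms(3) Tb by metis
  qed
  moreover have "\<exists>t::nat. t > 0 \<and> 2 - of_nat t - 1 / T b = -1"
    if "\<bar>\<Prod>k=1..b. T k\<bar> = 1" "T b = 1 / 2 \<or> T b < 0"
  proof -
    \<comment> \<open>For \<open>c = -1\<close>, the value \<open>T b = 1 / 2\<close> gives
      \<open>3 - 2 = 1\<close>, so the new entry is 1.\<close>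
    have "2 - (-1) - 1 / T b > 0" using that(2)
    proof
      assume "T b < 0" then show ?thesis using neg by linarith
    next
      assume "T b = 1 / 2" then show ?thesis by (simp only:) simp
    qed
    then show ?thesis
      using obtain_next_entry[of "1 / T b" "-1"] inv[OF that(1)] by (metis Ints_1 Ints_minus)
  qed
  moreover have "\<exists>t::nat. t > 0 \<and> 2 - of_nat t - 1 / T b = 1"
    if "\<bar>\<Prod>k=1..b. T k\<bar> = 1" "T b < 0"
  proof -
    have "2 - 1 - 1 / T b > 0" using neg[OF that(2)] by linarith
    then show ?thesis
      using obtain_next_entry[of "1 / T b" 1] inv[OF that(1)] by (metis Ints_1)
  qed
  ultimately show ?thesis using P by blast
qed

end
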